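(* Let $(X,\to,^*,1)$ be an implicative-orthomodular algebra and let $\mathcal{Z}(X)$ be its commutative center. Then $(\mathcal{Z}(X),\to,^*,1)$ is a Wajsberg subalgebra of $X$; that is, $\mathcal{Z}(X)$ contains $1$, is closed under $\to$ and $^*$, and with the restricted operations it is a Wajsberg algebra.
   Context: A BE algebra is an algebra $(X,\to,1)$ of type $(2,0)$ such that for all $x,y,z\in X$: $x\to x=1$; $x\to 1=1$; $1\to x=x$; $x\to (y\to z)=y\to (x\to z)$. Write $x\le y$ iff $x\to y=1$. It is bounded if there is $0\in X$ with $0\le x$ for all $x\in X$; then $x^*:=x\to 0$. It is involutive if it is bounded and $x^{**}=x$ for all $x\in X$; an involutive BE algebra is denoted $(X,\to,^*,1)$. In an involutive BE algebra define $x\Cup y=(x\to y)\to y$ and $x\Cap y=((x^*\to y^* )\to y^* )^*$. An implicative-orthomodular algebra is an involutive BE algebra satisfying $x\to (y\Cap (z\Cap x))=(x\to y)\Cap (x\to z)$ for all $x,y,z\in X$. In such an algebra, elements $x,y\in X$ commute, written $x\,\mathcal{C}\,y$, if $x\Cup y=y\Cup x$. The commutative center of $X$ is $\mathcal{Z}(X)=\{x\in X\mid x\,\mathcal{C}\,y \text{ for all } y\in X\}$. A Wajsberg algebra is an algebra $(X,\to,^*,1)$ of type $(2,1,0)$ such that for all $x,y,z\in X$: $1\to x=x$; $(y\to z)\to ((z\to x)\to (y\to x))=1$; $(x\to y)\to y=(y\to x)\to x$; $(x^*\to y^* )\to (y\to x)=1$.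
   Formalization: Here x and y commute means x⋓y = y⋓x (equivalently x⋒y = y⋒x), not x⋒y = y⋓x as printed; with the printed formula the commutative center is empty in every algebra with more than one element, so it would not contain 1. *)

theory Defs
  imports Main
begin

text \<open>
  Algebras are carrier-based, since the commutative center is a proper subset of the carrier
  in general: only the values of the operations on the carrier \<open>X\<close> matter.
\<close>

locale BE_algebra =
  fixes X :: "'a set"
    and imp :: "'a \<Rightarrow> 'a \<Rightarrow> 'a"  (infixr \<open>\<rightarrow>\<close> 60)
    and one :: 'a  (\<open>\<one>\<close>)
  assumes one_closed: "\<one> \<in> X"
    and imp_closed: "\<lbrakk>x \<in> X; y \<in> X\<rbrakk> \<Longrightarrow> x \<rightarrow> y \<in> X"
    and imp_self: "x \<in> X \<Longrightarrow> x \<rightarrow> x = \<one>"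
    and imp_one: "x \<in> X \<Longrightarrow> x \<rightarrow> \<one> = \<one>"
    and one_imp: "x \<in> X \<Longrightarrow> \<one> \<rightarrow> x = x"
    and exchange: "\<lbrakk>x \<in> X; y \<in> X; z \<in> X\<rbrakk> \<Longrightarrow> x \<rightarrow> (y \<rightarrow> z) = y \<rightarrow> (x \<rightarrow> z)"

definition BE_le :: "('a \<Rightarrow> 'a \<Rightarrow> 'a) \<Rightarrow> 'a \<Rightarrow> 'a \<Rightarrow> 'a \<Rightarrow> bool" where
  "BE_le imp one x y \<longleftrightarrow> imp x y = one"

text \<open>
  The least element is not part of the signature; as \<open>\<le>\<close> need not be antisymmetric in a BE
  algebra, a bounded one may have several least elements. In the involutive case it is
  unique: it is \<open>\<one>\<^sup>\<star>\<close>.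
\<close>

locale involutive_BE_algebra = BE_algebra X imp one
  for X :: "'a set"
    and imp :: "'a \<Rightarrow> 'a \<Rightarrow> 'a"  (infixr \<open>\<rightarrow>\<close> 60)
    and star :: "'a \<Rightarrow> 'a"  (\<open>_\<^sup>\<star>\<close> [1000] 1000)
    and one :: 'a  (\<open>\<one>\<close>) +
  assumes bounded: "\<exists>zero\<in>X. (\<forall>x\<in>X. BE_le (\<rightarrow>) \<one> zero x) \<and> (\<forall>x\<in>X. x\<^sup>\<star> = x \<rightarrow> zero)"
    and involutive: "x \<in> X \<Longrightarrow> x\<^sup>\<star>\<^sup>\<star> = x"

definition BE_cup :: "('a \<Rightarrow> 'a \<Rightarrow> 'a) \<Rightarrow> 'a \<Rightarrow> 'a \<Rightarrow> 'a" where
  "BE_cup imp x y = imp (imp x y) y"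

definition BE_cap :: "('a \<Rightarrow> 'a \<Rightarrow> 'a) \<Rightarrow> ('a \<Rightarrow> 'a) \<Rightarrow> 'a \<Rightarrow> 'a \<Rightarrow> 'a" where
  "BE_cap imp star x y = star (imp (imp (star x) (star y)) (star y))"

locale implicative_orthomodular_algebra = involutive_BE_algebra X imp star one
  for X :: "'a set"
    and imp :: "'a \<Rightarrow> 'a \<Rightarrow> 'a"  (infixr \<open>\<rightarrow>\<close> 60)
    and star :: "'a \<Rightarrow> 'a"  (\<open>_\<^sup>\<star>\<close> [1000] 1000)
    and one :: 'a  (\<open>\<one>\<close>) +
  assumes implicative_orthomodular:
    "\<lbrakk>x \<in> X; y \<in> X; z \<in> X\<rbrakk> \<Longrightarrow>
      x \<rightarrow> BE_cap (\<rightarrow>) star y (BE_cap (\<rightarrow>) star z x)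
        = BE_cap (\<rightarrow>) star (x \<rightarrow> y) (x \<rightarrow> z)"

definition BE_commute :: "('a \<Rightarrow> 'a \<Rightarrow> 'a) \<Rightarrow> 'a \<Rightarrow> 'a \<Rightarrow> bool" where
  "BE_commute imp x y \<longleftrightarrow> BE_cup imp x y = BE_cup imp y x"

definition commutative_center :: "'a set \<Rightarrow> ('a \<Rightarrow> 'a \<Rightarrow> 'a) \<Rightarrow> 'a set" where
  "commutative_center X imp = {x \<in> X. \<forall>y\<in>X. BE_commute imp x y}"

locale Wajsberg_algebra =
  fixes X :: "'a set"
    and imp :: "'a \<Rightarrow> 'a \<Rightarrow> 'a"  (infixr \<open>\<rightarrow>\<close> 60)
    and star :: "'a \<Rightarrow> 'a"  (\<open>_\<^sup>\<star>\<close> [1000] 1000)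
    and one :: 'a  (\<open>\<one>\<close>)
  assumes one_closed: "\<one> \<in> X"
    and imp_closed: "\<lbrakk>x \<in> X; y \<in> X\<rbrakk> \<Longrightarrow> x \<rightarrow> y \<in> X"
    and star_closed: "x \<in> X \<Longrightarrow> x\<^sup>\<star> \<in> X"
    and one_imp: "x \<in> X \<Longrightarrow> \<one> \<rightarrow> x = x"
    and imp_trans: "\<lbrakk>x \<in> X; y \<in> X; z \<in> X\<rbrakk> \<Longrightarrow> (y \<rightarrow> z) \<rightarrow> ((z \<rightarrow> x) \<rightarrow> (y \<rightarrow> x)) = \<one>"
    and imp_commute: "\<lbrakk>x \<in> X; y \<in> X\<rbrakk> \<Longrightarrow> (x \<rightarrow> y) \<rightarrow> y = (y \<rightarrow> x) \<rightarrow> x"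
    and contrapositive: "\<lbrakk>x \<in> X; y \<in> X\<rbrakk> \<Longrightarrow> (x\<^sup>\<star> \<rightarrow> y\<^sup>\<star>) \<rightarrow> (y \<rightarrow> x) = \<one>"

end

theory Submission
  imports Defs
begin

text \<open>
  Write \<open>x \<preceq> y\<close> for \<open>x \<Cap> y = x\<close>. This order is finer than \<open>BE_le\<close>, and for \<open>u \<preceq> x\<close> it gives
  \<open>u \<rightarrow> p = (x \<rightarrow> u) \<rightarrow> (x \<rightarrow> p)\<close>. Hence \<open>(y \<Cap> z) \<Cap> a = y \<Cap> (z \<Cap> a)\<close> as soon as \<open>z\<close> and
  \<open>a\<close> commute. Commuting for \<open>\<Cup>\<close> and commuting for \<open>\<Cap>\<close> are equivalent, so the center is
  closed under the involution.

  For central \<open>a, b\<close> put \<open>d = a \<rightarrow> b\<close> and \<open>k = a\<^sup>\<star>\<close>, so that \<open>k \<preceq> d\<close>, and let \<open>c\<close> be arbitrary.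
  The element \<open>k \<Cup> c\<close> has the form \<open>a \<rightarrow> z\<close>, and \<open>a \<rightarrow> b\<close> commutes with every such element
  because \<open>b\<close> is central. Therefore \<open>c \<Cap> d\<close> and \<open>d \<Cap> c\<close> have the same join with \<open>k\<close>; they also
  have the same meet with \<open>k\<close>, and an element is determined by its join and meet with a central
  element.
\<close>

context implicative_orthomodular_algebra
begin

abbreviation cup (infixl \<open>\<Cup>\<close> 65) where "x \<Cup> y \<equiv> BE_cup (\<rightarrow>) x y"
abbreviation cap (infixl \<open>\<Cap>\<close> 70) where "x \<Cap> y \<equiv> BE_cap (\<rightarrow>) star x y"

definition qle (infix \<open>\<preceq>\<close> 50) where "x \<preceq> y \<longleftrightarrow> x \<Cap> y = x"

section \<open>Least element, involution and contraposition\<close>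

lemma star_one_least:
  shows star_one_closed: "\<one>\<^sup>\<star> \<in> X"
    and star_one_imp: "x \<in> X \<Longrightarrow> \<one>\<^sup>\<star> \<rightarrow> x = \<one>"
    and star_eq: "x \<in> X \<Longrightarrow> x\<^sup>\<star> = x \<rightarrow> \<one>\<^sup>\<star>"
proof -
  obtain z where z: "z \<in> X" "\<forall>x\<in>X. BE_le (\<rightarrow>) \<one> z x" "\<forall>x\<in>X. x\<^sup>\<star> = x \<rightarrow> z"
    using bounded by blast
  have "\<one>\<^sup>\<star> = z"
    using z one_closed one_imp by simp
  then show "\<one>\<^sup>\<star> \<in> X" "x \<in> X \<Longrightarrow> \<one>\<^sup>\<star> \<rightarrow> x = \<one>" "x \<in> X \<Longrightarrow> x\<^sup>\<star> = x \<rightarrow> \<one>\<^sup>\<star>"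
    using z by (auto simp: BE_le_def)
qed

lemma star_closed: "x \<in> X \<Longrightarrow> x\<^sup>\<star> \<in> X"
  using star_eq imp_closed star_one_closed by simp

lemma cup_closed: "\<lbrakk>x \<in> X; y \<in> X\<rbrakk> \<Longrightarrow> x \<Cup> y \<in> X"
  by (simp add: BE_cup_def imp_closed)

lemma cap_closed: "\<lbrakk>x \<in> X; y \<in> X\<rbrakk> \<Longrightarrow> x \<Cap> y \<in> X"
  by (simp add: BE_cap_def imp_closed star_closed)

lemmas closed = one_closed imp_closed star_closed cup_closed cap_closed

lemma imp_star_swap: "\<lbrakk>x \<in> X; y \<in> X\<rbrakk> \<Longrightarrow> x \<rightarrow> y\<^sup>\<star> = y \<rightarrow> x\<^sup>\<star>"
  using exchange[of x y "\<one>\<^sup>\<star>"] star_eq star_one_closed by metis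

lemma star_imp_star: "\<lbrakk>x \<in> X; y \<in> X\<rbrakk> \<Longrightarrow> x\<^sup>\<star> \<rightarrow> y\<^sup>\<star> = y \<rightarrow> x"
  using imp_star_swap[of "x\<^sup>\<star>" y] by (simp add: closed involutive)

lemma star_cup: "\<lbrakk>x \<in> X; y \<in> X\<rbrakk> \<Longrightarrow> (x \<Cup> y)\<^sup>\<star> = x\<^sup>\<star> \<Cap> y\<^sup>\<star>"
  by (simp add: BE_cup_def BE_cap_def involutive)

lemma star_cap: "\<lbrakk>x \<in> X; y \<in> X\<rbrakk> \<Longrightarrow> (x \<Cap> y)\<^sup>\<star> = x\<^sup>\<star> \<Cup> y\<^sup>\<star>"
  by (simp add: BE_cup_def BE_cap_def involutive closed)

text \<open>In this form \<open>x \<Cap> y\<close> visibly depends on \<open>x\<close> only through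
  \<open>y \<rightarrow> x\<close>, so meets with the same right factor are compared by comparing
  implications.\<close>

lemma cap_eq: "\<lbrakk>x \<in> X; y \<in> X\<rbrakk> \<Longrightarrow> x \<Cap> y = (y \<rightarrow> (y \<rightarrow> x)\<^sup>\<star>)\<^sup>\<star>"
  using imp_star_swap[of "y \<rightarrow> x" y] by (simp add: BE_cap_def star_imp_star closed)

lemma star_cap_eq: "\<lbrakk>x \<in> X; y \<in> X\<rbrakk> \<Longrightarrow> (x \<Cap> y)\<^sup>\<star> = y \<rightarrow> (y \<rightarrow> x)\<^sup>\<star>"
  by (simp add: cap_eq involutive closed)

lemma cap_one: "x \<in> X \<Longrightarrow> x \<Cap> \<one> = x"
  by (simp add: cap_eq closed one_imp involutive)

lemma one_cap: "x \<in> X \<Longrightarrow> \<one> \<Cap> x = x"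
  by (simp add: cap_eq closed imp_one star_eq[symmetric] involutive)

lemma zero_cap: "x \<in> X \<Longrightarrow> \<one>\<^sup>\<star> \<Cap> x = \<one>\<^sup>\<star>"
  by (simp add: cap_eq closed star_eq[symmetric] involutive imp_self)

lemma cap_zero: "x \<in> X \<Longrightarrow> x \<Cap> \<one>\<^sup>\<star> = \<one>\<^sup>\<star>"
  by (simp add: cap_eq closed star_one_imp)

lemma star_imp_zero: "x \<in> X \<Longrightarrow> x\<^sup>\<star> \<rightarrow> \<one>\<^sup>\<star> = x"
  using star_eq[of "x\<^sup>\<star>"] by (simp add: closed involutive)

section \<open>Instances of the orthomodular law and the order \<open>\<preceq>\<close>\<close>

lemma imp_cap: "\<lbrakk>x \<in> X; y \<in> X\<rbrakk> \<Longrightarrow> x \<rightarrow> (y \<Cap> x) = x \<rightarrow> y"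
  using implicative_orthomodular[of x y \<one>] by (simp add: closed one_cap imp_one cap_one)

text \<open>With zero \<open>\<one>\<^sup>\<star>\<close> as one meet argument of the law, the
  nested meet collapses to zero, and
  \<open>x\<^sup>\<star> \<rightarrow> \<one>\<^sup>\<star>\<close> gives back
  \<open>x\<close>.\<close>

lemma cap_imp: "\<lbrakk>x \<in> X; y \<in> X\<rbrakk> \<Longrightarrow> x \<Cap> (y \<rightarrow> x) = x"
  using implicative_orthomodular[of "x\<^sup>\<star>" "\<one>\<^sup>\<star>" "y\<^sup>\<star>"]
  by (simp add: closed zero_cap star_imp_zero star_imp_star one_imp)

lemma imp_cap_self: "\<lbrakk>x \<in> X; y \<in> X\<rbrakk> \<Longrightarrow> (y \<rightarrow> x) \<Cap> x = x"
  using implicative_orthomodular[of "x\<^sup>\<star>" "y\<^sup>\<star>" "\<one>\<^sup>\<star>"]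
  by (simp add: closed zero_cap cap_zero star_imp_zero star_imp_star one_imp)

lemma cap_qle: "\<lbrakk>x \<in> X; y \<in> X\<rbrakk> \<Longrightarrow> x \<Cap> y \<preceq> y"
  unfolding qle_def using cap_eq[of "x \<Cap> y" y] by (simp add: closed imp_cap cap_eq[symmetric])

lemma qle_imp: "\<lbrakk>x \<in> X; y \<in> X\<rbrakk> \<Longrightarrow> x \<preceq> y \<rightarrow> x"
  by (simp add: qle_def cap_imp)

lemma qle_cup: "\<lbrakk>x \<in> X; y \<in> X\<rbrakk> \<Longrightarrow> x \<preceq> y \<Cup> x"
  by (simp add: BE_cup_def qle_imp closed)

text \<open>The involution turns this into \<open>y\<^sup>\<star> \<preceq> x\<^sup>\<star> \<Cup>
  y\<^sup>\<star>\<close>, an instance of \<open>qle_cup\<close>.\<close>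

lemma qle_cup_eq:
  assumes "x \<in> X" "y \<in> X" "x \<preceq> y"
  shows "y \<Cup> x = y"
proof -
  have "(y \<Cup> (x \<Cap> y))\<^sup>\<star> = y\<^sup>\<star> \<Cap> (x\<^sup>\<star> \<Cup> y\<^sup>\<star>)"
    using assms by (simp add: star_cup star_cap closed)
  also have "\<dots> = y\<^sup>\<star>"
    using assms qle_cup[of "y\<^sup>\<star>" "x\<^sup>\<star>"] by (simp add: closed qle_def)
  finally show ?thesis
    using assms by (metis qle_def cup_closed involutive)
qed

lemma qle_cap_eq: "\<lbrakk>x \<in> X; y \<in> X; x \<preceq> y\<rbrakk> \<Longrightarrow> y \<Cap> x = x"
  using qle_cup_eq[of x y] imp_cap_self[of x "y \<rightarrow> x"] by (simp add: BE_cup_def closed)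

lemma qle_star: "\<lbrakk>x \<in> X; y \<in> X; x \<preceq> y\<rbrakk> \<Longrightarrow> y\<^sup>\<star> \<preceq> x\<^sup>\<star>"
  using qle_cup_eq[of x y] by (simp add: qle_def star_cup[symmetric])

text \<open>Contraposition brings in \<open>u\<^sup>\<star>\<close>, which
  \<open>u \<preceq> x\<close> writes as
  \<open>x \<rightarrow> (x \<rightarrow> u)\<^sup>\<star>\<close>; exchange does the rest.\<close>

lemma qle_imp_eq:
  assumes "u \<in> X" "x \<in> X" "p \<in> X" "u \<preceq> x"
  shows "u \<rightarrow> p = (x \<rightarrow> u) \<rightarrow> (x \<rightarrow> p)"
proof -
  have "u \<rightarrow> p = p\<^sup>\<star> \<rightarrow> u\<^sup>\<star>"
    using assms by (simp add: star_imp_star)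
  also have "u\<^sup>\<star> = x \<rightarrow> (x \<rightarrow> u)\<^sup>\<star>"
    using assms star_cap_eq[of u x] by (simp add: qle_def)
  also have "p\<^sup>\<star> \<rightarrow> x \<rightarrow> (x \<rightarrow> u)\<^sup>\<star> = x \<rightarrow> p\<^sup>\<star> \<rightarrow> (x \<rightarrow> u)\<^sup>\<star>"
    using assms by (simp add: exchange closed)
  also have "\<dots> = x \<rightarrow> (x \<rightarrow> u) \<rightarrow> p"
    using assms by (simp add: star_imp_star closed)
  also have "\<dots> = (x \<rightarrow> u) \<rightarrow> (x \<rightarrow> p)"
    using assms by (simp add: exchange closed)
  finally show ?thesis .
qed

text \<open>Since \<open>y = (y \<rightarrow> x) \<rightarrow> x\<close>, exchange makes
  \<open>z \<rightarrow> y\<close> an implication with consequent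
  \<open>z \<rightarrow> x\<close>.\<close>

lemma imp_mono:
  assumes "x \<in> X" "y \<in> X" "z \<in> X" "x \<preceq> y"
  shows "z \<rightarrow> x \<preceq> z \<rightarrow> y"
proof -
  have "y = (y \<rightarrow> x) \<rightarrow> x"
    using assms qle_cup_eq by (simp add: BE_cup_def)
  then have "z \<rightarrow> y = (y \<rightarrow> x) \<rightarrow> z \<rightarrow> x"
    using assms exchange imp_closed by metis
  then show ?thesis
    using assms by (simp add: qle_imp closed)
qed

lemma imp_antimono: "\<lbrakk>x \<in> X; y \<in> X; z \<in> X; x \<preceq> y\<rbrakk> \<Longrightarrow> y \<rightarrow> z \<preceq> x \<rightarrow> z"
  using imp_mono[of "y\<^sup>\<star>" "x\<^sup>\<star>" "z\<^sup>\<star>"] by (simp add: closed qle_star star_imp_star)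

lemma cup_mono: "\<lbrakk>x \<in> X; y \<in> X; z \<in> X; x \<preceq> y\<rbrakk> \<Longrightarrow> x \<Cup> z \<preceq> y \<Cup> z"
  by (simp add: BE_cup_def imp_antimono closed)

section \<open>Transitivity of the order and associativity of meets\<close>

lemma qle_cap_cap:
  assumes "x \<in> X" "y \<in> X" "z \<in> X" "x \<preceq> y"
  shows "x \<Cap> (y \<Cap> z) = x \<Cap> z"
proof -
  define w where "w = y \<Cap> z"
  have w: "w \<in> X" "w \<preceq> z" "z \<rightarrow> w = z \<rightarrow> y"
    using assms by (simp_all add: w_def closed cap_qle imp_cap)
  let ?t = "(z \<rightarrow> y) \<rightarrow> (z \<rightarrow> x)"
  have "(x \<Cap> w)\<^sup>\<star> = w \<rightarrow> (w \<rightarrow> x)\<^sup>\<star>"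
    using assms w by (simp add: star_cap_eq)
  \<comment> \<open>As \<open>w \<preceq> z\<close>, first the inner and then the outer implication
    from \<open>w\<close> expands through \<open>z\<close>. A starred meet of
    \<open>z \<rightarrow> x\<close> and \<open>z \<rightarrow> y\<close> results, which
    monotonicity collapses.\<close>
  also have "\<dots> = w \<rightarrow> ?t\<^sup>\<star>"
    using assms w qle_imp_eq[of w z x] by simp
  also have "\<dots> = (z \<rightarrow> y) \<rightarrow> (z \<rightarrow> ?t\<^sup>\<star>)"
    using assms w qle_imp_eq[of w z "?t\<^sup>\<star>"] by (simp add: closed)
  also have "\<dots> = z \<rightarrow> ((z \<rightarrow> y) \<rightarrow> ?t\<^sup>\<star>)"
    using assms by (simp add: exchange closed)
  also have "\<dots> = z \<rightarrow> ((z \<rightarrow> x) \<Cap> (z \<rightarrow> y))\<^sup>\<star>"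
    using assms by (simp add: star_cap_eq closed)
  also have "\<dots> = z \<rightarrow> (z \<rightarrow> x)\<^sup>\<star>"
    using assms imp_mono[of x y z] by (simp add: qle_def)
  also have "\<dots> = (x \<Cap> z)\<^sup>\<star>"
    using assms by (simp add: star_cap_eq)
  finally show ?thesis
    using assms w by (metis w_def cap_closed involutive)
qed

lemma qle_trans: "\<lbrakk>x \<in> X; y \<in> X; z \<in> X; x \<preceq> y; y \<preceq> z\<rbrakk> \<Longrightarrow> x \<preceq> z"
  using qle_cap_cap[of x y z] by (simp add: qle_def)

text \<open>Expanded through \<open>x\<close>, \<open>u \<rightarrow> p\<close> depends on
  \<open>p\<close> only through \<open>x \<rightarrow> p\<close>, which is the same for
  \<open>y \<Cap> x\<close> and \<open>y\<close>.\<close>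

lemma qle_cap_absorb:
  assumes "u \<in> X" "x \<in> X" "y \<in> X" "u \<preceq> x"
  shows "(y \<Cap> x) \<Cap> u = y \<Cap> u"
proof -
  have "u \<rightarrow> (y \<Cap> x) = u \<rightarrow> y"
    using assms qle_imp_eq[of u x "y \<Cap> x"] qle_imp_eq[of u x y] by (simp add: closed imp_cap)
  then show ?thesis
    using assms by (simp add: cap_eq[of _ u] closed)
qed

text \<open>From \<open>x \<Cap> y \<preceq> y\<close>, the factor \<open>z\<close> may be replaced
  by \<open>y \<Cap> z\<close>; commutation puts \<open>y \<Cap> z\<close> below \<open>y\<close>,
  so the inner \<open>y\<close> is absorbed.\<close>

lemma cap_assoc:
  assumes "x \<in> X" "y \<in> X" "z \<in> X" "y \<Cap> z = z \<Cap> y"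
  shows "(x \<Cap> y) \<Cap> z = x \<Cap> (y \<Cap> z)"
proof -
  have "(x \<Cap> y) \<Cap> z = (x \<Cap> y) \<Cap> (y \<Cap> z)"
    using assms qle_cap_cap[of "x \<Cap> y" y z] by (simp add: closed cap_qle)
  also have "\<dots> = x \<Cap> (y \<Cap> z)"
    using assms cap_qle[of z y] by (simp add: closed qle_cap_absorb)
  finally show ?thesis .
qed

section \<open>Commuting for joins and meets, and cancellation\<close>

lemma cup_imp: "\<lbrakk>x \<in> X; y \<in> X\<rbrakk> \<Longrightarrow> (x \<Cup> y) \<rightarrow> y = x \<rightarrow> y"
  using qle_cup_eq[of y "x \<rightarrow> y"] by (simp add: BE_cup_def closed qle_imp)

text \<open>Expanding \<open>x\<^sup>\<star>\<close> and \<open>y\<^sup>\<star>\<close> through the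
  common join \<open>j\<close> makes the stars of the two meets differ only by a contraposition
  under \<open>j \<rightarrow>\<close>.\<close>

lemma cap_commute_if_cup_commute:
  assumes "x \<in> X" "y \<in> X" "x \<Cup> y = y \<Cup> x"
  shows "x \<Cap> y = y \<Cap> x"
proof -
  define j where "j = x \<Cup> y"
  have j: "j \<in> X" "x \<preceq> j" "y \<preceq> j" "j \<rightarrow> y = x \<rightarrow> y" "j \<rightarrow> x = y \<rightarrow> x"
    using assms qle_cup[of x y] qle_cup[of y x] cup_imp[of x y] cup_imp[of y x]
    by (simp_all add: j_def closed)
  have y: "y\<^sup>\<star> = j \<rightarrow> (x \<rightarrow> y)\<^sup>\<star>" and x: "x\<^sup>\<star> = j \<rightarrow> (y \<rightarrow> x)\<^sup>\<star>"
    using assms j star_cap_eq[of y j] star_cap_eq[of x j] by (simp_all add: qle_def)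
  have "(x \<Cap> y)\<^sup>\<star> = (y \<rightarrow> x) \<rightarrow> y\<^sup>\<star>"
    using assms by (simp add: star_cap_eq imp_star_swap closed)
  also have "\<dots> = j \<rightarrow> ((y \<rightarrow> x) \<rightarrow> (x \<rightarrow> y)\<^sup>\<star>)"
    using assms j y by (simp add: exchange closed)
  also have "\<dots> = j \<rightarrow> ((x \<rightarrow> y) \<rightarrow> (y \<rightarrow> x)\<^sup>\<star>)"
    using assms imp_star_swap[of "y \<rightarrow> x" "x \<rightarrow> y"] by (simp add: closed)
  also have "\<dots> = (x \<rightarrow> y) \<rightarrow> x\<^sup>\<star>"
    using assms j x by (simp add: exchange closed)
  also have "\<dots> = (y \<Cap> x)\<^sup>\<star>"
    using assms by (simp add: star_cap_eq imp_star_swap closed)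
  finally show ?thesis
    using assms by (metis cap_closed involutive)
qed

lemma cup_eq: "\<lbrakk>x \<in> X; y \<in> X\<rbrakk> \<Longrightarrow> x \<Cup> y = (x\<^sup>\<star> \<Cap> y\<^sup>\<star>)\<^sup>\<star>"
  by (simp add: star_cup[symmetric] involutive closed)

lemma cup_commute_if_cap_commute:
  assumes "x \<in> X" "y \<in> X" "x \<Cap> y = y \<Cap> x"
  shows "x \<Cup> y = y \<Cup> x"
proof -
  have "x\<^sup>\<star> \<Cup> y\<^sup>\<star> = y\<^sup>\<star> \<Cup> x\<^sup>\<star>"
    using assms star_cap[of x y] star_cap[of y x] by simp
  then have "x\<^sup>\<star> \<Cap> y\<^sup>\<star> = y\<^sup>\<star> \<Cap> x\<^sup>\<star>"
    using assms by (simp add: cap_commute_if_cup_commute closed)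
  then show ?thesis
    using assms by (simp add: cup_eq)
qed

lemma imp_cup:
  assumes "x \<in> X" "y \<in> X" "z \<in> X" "y \<preceq> x"
  shows "x \<rightarrow> (y \<Cup> z) = (x \<rightarrow> y) \<Cup> (x \<rightarrow> z)"
  using assms qle_imp_eq[of y x z] by (simp add: BE_cup_def exchange closed)

text \<open>The meet determines \<open>k \<rightarrow> x\<close>. Then
  \<open>x = x \<Cap> (k \<rightarrow> x)\<close> depends on the left factor only through
  \<open>(k \<rightarrow> x) \<rightarrow> x\<close>, which is the join.\<close>

lemma cup_cap_cancel:
  assumes "k \<in> X" "x \<in> X" "y \<in> X" "k \<Cup> x = k \<Cup> y" "x \<Cap> k = y \<Cap> k"
  shows "x = y"
proof -
  have t: "k \<rightarrow> x = k \<rightarrow> y"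
    using assms imp_cap[of k x] imp_cap[of k y] by simp
  have "x = x \<Cap> (k \<rightarrow> x)"
    using assms by (simp add: cap_imp)
  also have "\<dots> = y \<Cap> (k \<rightarrow> y)"
    using assms t by (simp add: cap_eq closed BE_cup_def)
  also have "\<dots> = y"
    using assms by (simp add: cap_imp)
  finally show ?thesis .
qed

section \<open>The commutative center and its closure properties\<close>

abbreviation center (\<open>\<Z>\<close>) where "\<Z> \<equiv> commutative_center X (\<rightarrow>)"

lemma center_iff: "a \<in> \<Z> \<longleftrightarrow> a \<in> X \<and> (\<forall>y\<in>X. a \<Cap> y = y \<Cap> a)"
  unfolding commutative_center_def BE_commute_def
  using cap_commute_if_cup_commute cup_commute_if_cap_commute by blast

lemma center_closed: "a \<in> \<Z> \<Longrightarrow> a \<in> X"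
  by (simp add: center_iff)

lemma center_cap: "\<lbrakk>a \<in> \<Z>; y \<in> X\<rbrakk> \<Longrightarrow> a \<Cap> y = y \<Cap> a"
  by (simp add: center_iff)

lemma center_cup: "\<lbrakk>a \<in> \<Z>; y \<in> X\<rbrakk> \<Longrightarrow> a \<Cup> y = y \<Cup> a"
  by (simp add: commutative_center_def BE_commute_def)

lemma one_center: "\<one> \<in> \<Z>"
  by (simp add: center_iff closed one_cap cap_one)

lemma star_center:
  assumes "a \<in> \<Z>"
  shows "a\<^sup>\<star> \<in> \<Z>"
proof -
  have a: "a \<in> X"
    using assms by (rule center_closed)
  have "a\<^sup>\<star> \<Cap> y = y \<Cap> a\<^sup>\<star>" if y: "y \<in> X" for y
    using a y star_cup[of a "y\<^sup>\<star>"] star_cup[of "y\<^sup>\<star>" a] center_cup[OF assms, of "y\<^sup>\<star>"]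
    by (simp add: closed involutive)
  then show ?thesis
    using a by (simp add: center_iff closed)
qed

text \<open>The orthomodular law rewrites the two sides as
  \<open>y \<rightarrow> (b \<Cap> (z \<Cap> y))\<close> and
  \<open>y \<rightarrow> (z \<Cap> (b \<Cap> y))\<close>; centrality of \<open>b\<close> identifies
  the inner meets.\<close>

lemma imp_center_commute:
  assumes b: "b \<in> \<Z>" and y: "y \<in> X" and z: "z \<in> X"
  shows "(y \<rightarrow> b) \<Cap> (y \<rightarrow> z) = (y \<rightarrow> z) \<Cap> (y \<rightarrow> b)"
proof -
  have bX: "b \<in> X"
    using b by (rule center_closed)
  have "b \<Cap> (z \<Cap> y) = (z \<Cap> y) \<Cap> b"
    using center_cap[OF b] y z by (simp add: closed)
  also have "\<dots> = z \<Cap> (b \<Cap> y)"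
    using center_cap[OF b y] bX y z by (simp add: cap_assoc)
  finally show ?thesis
    using bX y z implicative_orthomodular[of y b z] implicative_orthomodular[of y z b] by simp
qed

lemma center_imp_cap:
  assumes a: "a \<in> \<Z>" and y: "y \<in> X" and z: "z \<in> X"
  shows "a \<rightarrow> (y \<Cap> z) = (a \<rightarrow> y) \<Cap> (a \<rightarrow> z)"
proof -
  have aX: "a \<in> X"
    using a by (rule center_closed)
  have "a \<rightarrow> (y \<Cap> z) = a \<rightarrow> ((y \<Cap> z) \<Cap> a)"
    using aX y z by (simp add: imp_cap closed)
  also have "\<dots> = a \<rightarrow> (y \<Cap> (z \<Cap> a))"
    using center_cap[OF a z] aX y z by (simp add: cap_assoc)
  finally show ?thesis
    using aX y z by (simp add: implicative_orthomodular)
qed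

text \<open>Presents the join as an implication from \<open>k\<^sup>\<star>\<close>, to which the
  results on implications from a central element apply.\<close>

lemma center_cup_eq:
  assumes k: "k \<in> \<Z>" and w: "w \<in> X"
  shows "k \<Cup> w = k\<^sup>\<star> \<rightarrow> (k\<^sup>\<star> \<rightarrow> w\<^sup>\<star>)\<^sup>\<star>"
proof -
  have "k \<Cup> w = (w\<^sup>\<star> \<Cap> k\<^sup>\<star>)\<^sup>\<star>"
    using center_cup[OF k w] cup_eq[of w k] k w by (simp add: center_closed)
  then show ?thesis
    using k w by (simp add: star_cap_eq center_closed closed)
qed

text \<open>A modular law: in the form of \<open>center_cup_eq\<close>, the inner implication
  distributes because \<open>d\<^sup>\<star> \<preceq> k\<^sup>\<star>\<close>, the outer one
  because \<open>k\<^sup>\<star>\<close> is central.\<close>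

lemma center_cup_cap_left:
  assumes k: "k \<in> \<Z>" and d: "d \<in> X" and c: "c \<in> X" and kd: "k \<preceq> d"
  shows "k \<Cup> (d \<Cap> c) = d \<Cap> (k \<Cup> c)"
proof -
  have kX: "k \<in> X"
    using k by (rule center_closed)
  have dk: "d\<^sup>\<star> \<preceq> k\<^sup>\<star>"
    using kX d kd by (rule qle_star)
  have kd': "k \<Cup> d = d"
    using k kX d kd by (simp add: center_cup qle_cup_eq)
  have "k\<^sup>\<star> \<rightarrow> (d \<Cap> c)\<^sup>\<star> = (k\<^sup>\<star> \<rightarrow> d\<^sup>\<star>) \<Cup> (k\<^sup>\<star> \<rightarrow> c\<^sup>\<star>)"
    using kX d c dk by (simp add: star_cap imp_cup closed)
  then have "k \<Cup> (d \<Cap> c) = k\<^sup>\<star> \<rightarrow> ((k\<^sup>\<star> \<rightarrow> d\<^sup>\<star>)\<^sup>\<star> \<Cap> (k\<^sup>\<star> \<rightarrow> c\<^sup>\<star>)\<^sup>\<star>)"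
    using k kX d c by (simp add: center_cup_eq star_cup closed)
  also have "\<dots> = (k \<Cup> d) \<Cap> (k \<Cup> c)"
    using k kX d c by (simp add: center_imp_cap star_center center_cup_eq closed)
  finally show ?thesis
    by (simp add: kd')
qed

lemma center_cup_cap_right:
  assumes k: "k \<in> \<Z>" and d: "d \<in> X" and c: "c \<in> X" and kd: "k \<preceq> d"
  shows "k \<Cup> (c \<Cap> d) = (k \<Cup> c) \<Cap> d"
proof -
  have kX: "k \<in> X"
    using k by (rule center_closed)
  define s where "s = c \<Cap> d"
  have s: "s \<in> X" "s \<preceq> d" "d \<rightarrow> s = d \<rightarrow> c"
    using d c by (simp_all add: s_def closed cap_qle imp_cap)
  \<comment> \<open>Being below \<open>d\<close>, the element \<open>s \<Cup> k\<close> is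
    determined by \<open>d \<rightarrow> (s \<Cup> k)\<close>, so it suffices to match this with
    \<open>d \<rightarrow> (k \<Cup> c)\<close>.\<close>
  have sk: "s \<Cup> k \<preceq> d"
    using cup_mono[of s d k] qle_cup_eq[of k d] s kX d kd by simp
  have "d \<rightarrow> (s \<Cup> k) = (s \<rightarrow> k) \<rightarrow> (d \<rightarrow> k)"
    using s kX d by (simp add: BE_cup_def exchange closed)
  also have "\<dots> = (d \<rightarrow> c) \<Cup> (d \<rightarrow> k)"
    using s kX d qle_imp_eq[of s d k] by (simp add: BE_cup_def)
  also have "\<dots> = (d \<rightarrow> k) \<Cup> (d \<rightarrow> c)"
    using k kX d c imp_center_commute[of k d c]
    by (intro cup_commute_if_cap_commute) (simp_all add: closed)
  also have "\<dots> = d \<rightarrow> (k \<Cup> c)"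
    using kX d c kd by (simp add: imp_cup)
  finally have "(s \<Cup> k) \<Cap> d = (k \<Cup> c) \<Cap> d"
    using s kX d c by (simp add: cap_eq[of _ d] closed)
  then show ?thesis
    using sk center_cup[OF k s(1)] by (simp add: qle_def s_def)
qed

lemma imp_center:
  assumes a: "a \<in> \<Z>" and b: "b \<in> \<Z>"
  shows "a \<rightarrow> b \<in> \<Z>"
proof -
  have aX: "a \<in> X" and bX: "b \<in> X"
    using a b by (simp_all add: center_closed)
  define d k where "d = a \<rightarrow> b" and "k = a\<^sup>\<star>"
  have k: "k \<in> \<Z>" "k \<in> X" and d: "d \<in> X"
    using a aX bX by (simp_all add: k_def d_def star_center closed)
  have kd: "k \<preceq> d"
    using aX bX qle_imp[of "a\<^sup>\<star>" "b\<^sup>\<star>"] by (simp add: k_def d_def star_imp_star closed)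
  have "d \<Cap> c = c \<Cap> d" if c: "c \<in> X" for c
  proof (rule cup_cap_cancel)
    have "k \<Cup> c = a \<rightarrow> (a \<rightarrow> c\<^sup>\<star>)\<^sup>\<star>"
      using k c center_cup_eq[of k c] aX by (simp add: k_def involutive)
    then have "d \<Cap> (k \<Cup> c) = (k \<Cup> c) \<Cap> d"
      using imp_center_commute[OF b, of a "(a \<rightarrow> c\<^sup>\<star>)\<^sup>\<star>"] aX c by (simp add: d_def closed)
    then show "k \<Cup> (d \<Cap> c) = k \<Cup> (c \<Cap> d)"
      using k d c kd by (simp add: center_cup_cap_left center_cup_cap_right)
    \<comment> \<open>Both meets with \<open>k\<close> reduce to \<open>c \<Cap> k\<close>, because
      \<open>c \<Cap> k\<close> and \<open>k\<close> lie below \<open>d\<close>.\<close>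
    have "c \<Cap> k \<preceq> d"
      using qle_trans[of "c \<Cap> k" k d] cap_qle[of c k] k d c kd by (simp add: closed)
    then have "(d \<Cap> c) \<Cap> k = c \<Cap> k"
      using k d c center_cap[of k c] by (simp add: cap_assoc qle_cap_eq closed)
    moreover have "(c \<Cap> d) \<Cap> k = c \<Cap> k"
      using k d c kd center_cap[of k d] by (simp add: cap_assoc qle_cap_eq)
    ultimately show "(d \<Cap> c) \<Cap> k = (c \<Cap> d) \<Cap> k"
      by simp
  qed (use k d c in \<open>simp_all add: closed\<close>)
  then show ?thesis
    using d by (simp add: center_iff d_def)
qed

section \<open>The Wajsberg axioms on the center\<close>

lemma center_imp_trans:
  assumes y: "y \<in> \<Z>" and x: "x \<in> X" and z: "z \<in> X"
  shows "(y \<rightarrow> z) \<rightarrow> ((z \<rightarrow> x) \<rightarrow> (y \<rightarrow> x)) = \<one>"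
proof -
  have yX: "y \<in> X"
    using y by (rule center_closed)
  \<comment> \<open>Centrality of \<open>y\<^sup>\<star>\<close> makes the join symmetric, so
    \<open>y\<close> and \<open>z\<close> can be interchanged on the left; afterwards
    \<open>z \<rightarrow> x\<close> implies itself.\<close>
  have "(y \<rightarrow> z) \<rightarrow> (y \<rightarrow> x) = x\<^sup>\<star> \<rightarrow> (z\<^sup>\<star> \<Cup> y\<^sup>\<star>)"
    using x yX z exchange[of "z\<^sup>\<star> \<rightarrow> y\<^sup>\<star>" "x\<^sup>\<star>" "y\<^sup>\<star>"]
    by (simp add: BE_cup_def star_imp_star closed)
  also have "\<dots> = x\<^sup>\<star> \<rightarrow> (y\<^sup>\<star> \<Cup> z\<^sup>\<star>)"
    using center_cup[OF star_center[OF y], of "z\<^sup>\<star>"] z by (simp add: closed)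
  also have "\<dots> = (z \<rightarrow> y) \<rightarrow> (z \<rightarrow> x)"
    using x yX z exchange[of "y\<^sup>\<star> \<rightarrow> z\<^sup>\<star>" "x\<^sup>\<star>" "z\<^sup>\<star>"]
    by (simp add: BE_cup_def star_imp_star closed)
  finally have "(y \<rightarrow> z) \<rightarrow> ((z \<rightarrow> x) \<rightarrow> (y \<rightarrow> x)) = (z \<rightarrow> x) \<rightarrow> ((z \<rightarrow> y) \<rightarrow> (z \<rightarrow> x))"
    using x yX z exchange[of "y \<rightarrow> z" "z \<rightarrow> x" "y \<rightarrow> x"] by (simp add: closed)
  also have "\<dots> = \<one>"
    using x yX z exchange[of "z \<rightarrow> x" "z \<rightarrow> y" "z \<rightarrow> x"] by (simp add: closed imp_self imp_one)
  finally show ?thesis .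
qed

lemma center_Wajsberg: "Wajsberg_algebra \<Z> (\<rightarrow>) star \<one>"
proof
  fix x y assume xy: "x \<in> \<Z>" "y \<in> \<Z>"
  show "(x \<rightarrow> y) \<rightarrow> y = (y \<rightarrow> x) \<rightarrow> x"
    using xy center_cup[of x y] by (simp add: BE_cup_def center_closed)
  show "(x\<^sup>\<star> \<rightarrow> y\<^sup>\<star>) \<rightarrow> (y \<rightarrow> x) = \<one>"
    using xy by (simp add: center_closed star_imp_star imp_self closed)
qed (simp_all add: one_center imp_center star_center center_imp_trans one_imp center_closed)

end

theorem theorem5p12:
  fixes X :: "'a set"
    and imp :: "'a \<Rightarrow> 'a \<Rightarrow> 'a"
    and star :: "'a \<Rightarrow> 'a"
    and one :: 'a
  assumes "implicative_orthomodular_algebra X imp star one"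
  shows "commutative_center X imp \<subseteq> X
    \<and> one \<in> commutative_center X imp
    \<and> (\<forall>x\<in>commutative_center X imp. \<forall>y\<in>commutative_center X imp.
          imp x y \<in> commutative_center X imp)
    \<and> (\<forall>x\<in>commutative_center X imp. star x \<in> commutative_center X imp)
    \<and> Wajsberg_algebra (commutative_center X imp) imp star one"
proof -
  interpret implicative_orthomodular_algebra X imp star one
    by (fact assms)
  show ?thesis
    using center_closed one_center imp_center star_center center_Wajsberg by blast
qed

end
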